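(* Let $S$ be a semigroup which is a disjoint union of finitely many copies of the free monogenic semigroup, i.e. $S=\bigsqcup_{a\in A}N_a$, where $A\subset S$ is a finite set and, for each $a\in A$, $N_a=\langle a\rangle=\{a^i: i\in\mathbb{Z}_{>0}\}$ is a subsemigroup isomorphic to $(\mathbb{Z}_{>0},+)$. Then $S$ has linear growth: there exists a constant $C>0$ such that for every integer $m\ge 1$ the set $J(m)$ of elements of $S$ which can be represented by a word of length $\le m$ in the generators $A$ satisfies $|J(m)|\le Cm$.
   Context: The free monogenic semigroup is $(\mathbb{Z}_{>0},+)$. An element $w\in S$ is represented by a word of length $n\geq 1$ in $A$ if $w=a_1a_2\cdots a_n$ for some $a_1,\dots,a_n\in A$. The set $A$ generates $S$. The products of elements from different $N_a$ are arbitrary subject to $S$ being a semigroup. *)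

theory Defs
  imports Complex_Main "HOL-Library.Disjoint_Sets"
begin

text \<open>Semigroups are given by an explicit carrier set and a binary operation; the values of the
  operation outside the carrier are irrelevant.\<close>

definition semigroup_on :: "'a set \<Rightarrow> ('a \<Rightarrow> 'a \<Rightarrow> 'a) \<Rightarrow> bool" where
  "semigroup_on S f \<longleftrightarrow>
     (\<forall>x\<in>S. \<forall>y\<in>S. f x y \<in> S) \<and>
     (\<forall>x\<in>S. \<forall>y\<in>S. \<forall>z\<in>S. f (f x y) z = f x (f y z))"

definition subsemigroup :: "'a set \<Rightarrow> 'a set \<Rightarrow> ('a \<Rightarrow> 'a \<Rightarrow> 'a) \<Rightarrow> bool" where
  "subsemigroup T S f \<longleftrightarrow> T \<subseteq> S \<and> (\<forall>x\<in>T. \<forall>y\<in>T. f x y \<in> T)"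

definition semigroup_isomorphic ::
  "'a set \<Rightarrow> ('a \<Rightarrow> 'a \<Rightarrow> 'a) \<Rightarrow> 'b set \<Rightarrow> ('b \<Rightarrow> 'b \<Rightarrow> 'b) \<Rightarrow> bool" where
  "semigroup_isomorphic S f T g \<longleftrightarrow>
     (\<exists>h. bij_betw h S T \<and> (\<forall>x\<in>S. \<forall>y\<in>S. h (f x y) = g (h x) (h y)))"

text \<open>The product of a word. A semigroup need not have an identity, so the value on the empty word
  is left unspecified.\<close>

fun word_prod :: "('a \<Rightarrow> 'a \<Rightarrow> 'a) \<Rightarrow> 'a list \<Rightarrow> 'a" where
  "word_prod f [a] = a"
| "word_prod f (a # b # w) = f a (word_prod f (b # w))"

text \<open>The power \<open>a\<^sup>i\<close>, meaningful for \<open>i \<ge> 1\<close>.\<close>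

definition pos_power :: "('a \<Rightarrow> 'a \<Rightarrow> 'a) \<Rightarrow> 'a \<Rightarrow> nat \<Rightarrow> 'a" where
  "pos_power f a i = word_prod f (replicate i a)"

definition monogenic :: "('a \<Rightarrow> 'a \<Rightarrow> 'a) \<Rightarrow> 'a \<Rightarrow> 'a set" where
  "monogenic f a = {pos_power f a i | i. i \<ge> 1}"

definition words_ball :: "'a set \<Rightarrow> ('a \<Rightarrow> 'a \<Rightarrow> 'a) \<Rightarrow> 'a set \<Rightarrow> nat \<Rightarrow> 'a set" where
  "words_ball S f A m =
     {x \<in> S. \<exists>w. 1 \<le> length w \<and> length w \<le> m \<and> set w \<subseteq> A \<and> x = word_prod f w}"

end

theory Submission
  imports Defs
begin

text \<open>Write \<open>c \<prec> d\<close> with slope \<open>\<sigma> / s > 0\<close> if \<open>d\<^sup>t c\<^sup>s = d\<^sup>t\<^sup>+\<^sup>\<sigma>\<close> for all large \<open>t\<close>. Slopes are unique and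
  multiplicative along chains \<open>c \<prec> d \<prec> e\<close>, so the weight \<open>\<omega>(d)\<close>, the maximum of \<open>1\<close> and of all
  slopes of \<open>d \<prec> e\<close>, satisfies \<open>\<lambda> \<omega>(d) \<le> \<omega>(c)\<close> whenever \<open>c \<prec> d\<close> with slope \<open>\<lambda>\<close>. If
  \<open>a c\<^sup>r = d\<^sup>t\<close> and \<open>a c\<^sup>r\<^sup>' = d\<^sup>t\<^sup>'\<close> with \<open>r < r'\<close>, then \<open>d\<^sup>t c\<^sup>r\<^sup>'\<^sup>-\<^sup>r = d\<^sup>t\<^sup>'\<close>; hence, up to a bounded error,
  multiplication by a generator acts on exponents with these slopes, and so it increases the
  weighted exponent \<open>\<omega>(c) r\<close> of \<open>c\<^sup>r\<close> by at most a constant. Therefore a word of length \<open>n\<close>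
  represents some \<open>d\<^sup>t\<close> with \<open>t = O(n)\<close>.\<close>

text \<open>The isomorphism of each \<open>monogenic f a\<close> with the positive integers is
  recast as injectivity of exponents.\<close>

locale monogenic_union =
  fixes S A :: "'a set" and f :: "'a \<Rightarrow> 'a \<Rightarrow> 'a"
  assumes semigroup: "semigroup_on S f"
    and gens: "A \<subseteq> S" "finite A"
    and inj_power: "a \<in> A \<Longrightarrow> inj_on (pos_power f a) {0<..}"
    and union: "S = (\<Union>a\<in>A. monogenic f a)"
begin

abbreviation pw :: "'a \<Rightarrow> nat \<Rightarrow> 'a" where "pw \<equiv> pos_power f"

lemma closed: "x \<in> S \<Longrightarrow> y \<in> S \<Longrightarrow> f x y \<in> S"
  and assoc: "x \<in> S \<Longrightarrow> y \<in> S \<Longrightarrow> z \<in> S \<Longrightarrow> f (f x y) z = f x (f y z)"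
  using semigroup unfolding semigroup_on_def by blast+

lemma pw_1 [simp]: "pw a (Suc 0) = a"
  by (simp add: pos_power_def)

lemma pw_Suc: "0 < i \<Longrightarrow> pw a (Suc i) = f a (pw a i)"
  by (cases i) (simp_all add: pos_power_def)

lemma pw_closed [intro]: "a \<in> A \<Longrightarrow> 0 < i \<Longrightarrow> pw a i \<in> S"
  using union by (auto simp: monogenic_def Suc_le_eq)

lemma pw_add:
  assumes "a \<in> A" "0 < i" "0 < j"
  shows "pw a (i + j) = f (pw a i) (pw a j)"
  using assms(2)
proof (induction i rule: nat_induct_non_zero)
  case 1
  then show ?case using assms by (simp add: pw_Suc)
next
  case (Suc i)
  then show ?case using assms gens by (auto simp: pw_Suc assoc pw_closed subsetD)
qed

lemma pw_eq_iff: "a \<in> A \<Longrightarrow> 0 < i \<Longrightarrow> 0 < j \<Longrightarrow> pw a i = pw a j \<longleftrightarrow> i = j"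
  using inj_power by (auto simp: inj_on_def)

section \<open>Eventual shifts of exponents and their slopes\<close>

text \<open>The threshold \<open>T\<close> is explicit so that shifts can be composed at concrete
  exponents. \<open>0 < \<sigma>\<close> keeps slopes positive.\<close>

definition shifts :: "'a \<Rightarrow> 'a \<Rightarrow> nat \<Rightarrow> nat \<Rightarrow> nat \<Rightarrow> bool" where
  "shifts c d s \<sigma> T \<longleftrightarrow> 0 < s \<and> 0 < \<sigma> \<and> 0 < T \<and> (\<forall>t\<ge>T. f (pw d t) (pw c s) = pw d (t + \<sigma>))"

lemma shifts_mult:
  assumes "c \<in> A" "d \<in> A" "shifts c d s \<sigma> T" "0 < k"
  shows "shifts c d (k * s) (k * \<sigma>) T"
  using assms(4)
proof (induction k rule: nat_induct_non_zero)
  case 1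
  then show ?case using assms by simp
next
  case (Suc k)
  have "f (pw d t) (pw c (k * s + s)) = pw d (t + (k * \<sigma> + \<sigma>))" if "t \<ge> T" for t
  proof -
    have "f (pw d t) (pw c (k * s + s)) = f (f (pw d t) (pw c (k * s))) (pw c s)"
      using Suc.hyps assms that
      by (subst assoc) (auto simp: pw_add[of c] shifts_def)
    also have "\<dots> = pw d (t + k * \<sigma> + \<sigma>)"
      using Suc assms that by (simp add: shifts_def)
    finally show ?thesis by (simp add: add.assoc)
  qed
  then show ?case using Suc assms by (simp add: shifts_def add.commute)
qed

text \<open>A large power of \<open>e\<close> splits off a factor \<open>pw d (T * u)\<close>. This
  factor lies beyond the threshold \<open>T\<close>, so it absorbs \<open>pw c (u * s)\<close>; the
  exponent of \<open>d\<close> remains a multiple of \<open>u\<close>, so \<open>e\<close> can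
  absorb it again.\<close>

lemma shifts_trans:
  assumes A: "c \<in> A" "d \<in> A" "e \<in> A"
    and cd: "shifts c d s \<sigma> T" and de: "shifts d e u \<tau> V"
  shows "shifts c e (u * s) (\<sigma> * \<tau>) (V + T * \<tau>)"
proof -
  have pos: "0 < s" "0 < \<sigma>" "0 < T" "0 < u" "0 < \<tau>" "0 < V"
    using cd de by (auto simp: shifts_def)
  have cd': "shifts c d (u * s) (u * \<sigma>) T"
    using shifts_mult[OF A(1,2) cd] pos by blast
  have de': "f (pw e v) (pw d (k * u)) = pw e (v + k * \<tau>)" if "V \<le> v" "0 < k" for v k
    using shifts_mult[OF A(2,3) de] that by (auto simp: shifts_def)
  have "f (pw e t) (pw c (u * s)) = pw e (t + \<sigma> * \<tau>)" if "V + T * \<tau> \<le> t" for t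
  proof -
    define v where "v = t - T * \<tau>"
    have v: "V \<le> v" "t = v + T * \<tau>" using that by (auto simp: v_def)
    have "f (pw e t) (pw c (u * s)) = f (f (pw e v) (pw d (T * u))) (pw c (u * s))"
      using v pos by (simp add: de')
    also have "\<dots> = f (pw e v) (f (pw d (T * u)) (pw c (u * s)))"
      using v pos A by (intro assoc pw_closed) auto
    also have "f (pw d (T * u)) (pw c (u * s)) = pw d (T * u + u * \<sigma>)"
      using cd' pos by (simp add: shifts_def)
    also have "T * u + u * \<sigma> = (T + \<sigma>) * u" by (simp add: algebra_simps)
    also have "f (pw e v) (pw d ((T + \<sigma>) * u)) = pw e (v + (T + \<sigma>) * \<tau>)"
      using v pos by (intro de') auto
    also have "v + (T + \<sigma>) * \<tau> = t + \<sigma> * \<tau>" using v by (simp add: algebra_simps)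
    finally show ?thesis .
  qed
  then show ?thesis using pos by (simp add: shifts_def)
qed

definition slope :: "'a \<Rightarrow> 'a \<Rightarrow> real \<Rightarrow> bool" where
  "slope c d l \<longleftrightarrow> (\<exists>s \<sigma> T. shifts c d s \<sigma> T \<and> l = real \<sigma> / real s)"

lemma slope_trans:
  assumes "c \<in> A" "d \<in> A" "e \<in> A" "slope c d l" "slope d e m"
  shows "slope c e (l * m)"
proof -
  obtain s \<sigma> T u \<tau> V where "shifts c d s \<sigma> T" "l = real \<sigma> / real s"
    "shifts d e u \<tau> V" "m = real \<tau> / real u"
    using assms(4,5) by (auto simp: slope_def)
  then have "shifts c e (u * s) (\<sigma> * \<tau>) (V + T * \<tau>)" "l * m = real (\<sigma> * \<tau>) / real (u * s)"
    using shifts_trans[OF assms(1-3)] by (simp_all add: mult.commute)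
  then show ?thesis unfolding slope_def by blast
qed

text \<open>Both shifts are scaled to the common exponent \<open>u * s\<close> of \<open>c\<close>
  and applied at \<open>T + V\<close>, beyond both thresholds; injectivity of the powers of
  \<open>d\<close> equates the results.\<close>

lemma slope_unique:
  assumes "c \<in> A" "d \<in> A" "slope c d l" "slope c d m"
  shows "l = m"
proof -
  obtain s \<sigma> T u \<tau> V where 1: "shifts c d s \<sigma> T" "l = real \<sigma> / real s"
    and 2: "shifts c d u \<tau> V" "m = real \<tau> / real u"
    using assms(3,4) by (auto simp: slope_def)
  have pos: "0 < s" "0 < T" "0 < u" using 1 2 by (auto simp: shifts_def)
  have "shifts c d (u * s) (u * \<sigma>) T" "shifts c d (u * s) (s * \<tau>) V"
    using shifts_mult[OF assms(1,2) 1(1), of u] shifts_mult[OF assms(1,2) 2(1), of s] pos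
    by (simp_all add: mult.commute)
  then have "pw d (T + V + u * \<sigma>) = pw d (T + V + s * \<tau>)"
    unfolding shifts_def by (metis le_add1 le_add2)
  then have "u * \<sigma> = s * \<tau>"
    using pos assms(2) by (simp add: pw_eq_iff)
  then have "real u * real \<sigma> = real s * real \<tau>"
    by (metis of_nat_mult)
  then show ?thesis unfolding 1(2) 2(2) using pos by (simp add: frac_eq_eq mult.commute)
qed

lemma finite_slopes:
  assumes "d \<in> A"
  shows "finite {l. \<exists>e\<in>A. slope d e l}"
proof -
  have "finite {l. slope d e l}" if "e \<in> A" for e
  proof (cases "\<exists>l. slope d e l")
    case True
    then obtain l where "slope d e l" ..
    then have "{l. slope d e l} \<subseteq> {l}" using slope_unique assms that by blast
    then show ?thesis by (rule finite_subset) simp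
  qed simp
  then have "finite (\<Union>e\<in>A. {l. slope d e l})" using gens by blast
  then show ?thesis by (rule rev_finite_subset) auto
qed

section \<open>Weights of generators\<close>

text \<open>Inserting 1 makes the maximum exist when \<open>d\<close> has no slopes, and lets a
  bound on a weighted exponent bound the exponent itself.\<close>

definition weight :: "'a \<Rightarrow> real" where
  "weight d = Max (insert 1 {l. \<exists>e\<in>A. slope d e l})"

lemma weight_ge_1: "d \<in> A \<Longrightarrow> 1 \<le> weight d"
  unfolding weight_def using finite_slopes by (intro Max_ge) auto

lemma slope_le_weight: "d \<in> A \<Longrightarrow> e \<in> A \<Longrightarrow> slope d e l \<Longrightarrow> l \<le> weight d"
  unfolding weight_def using finite_slopes by (intro Max_ge) auto

text \<open>If \<open>weight d\<close> is a slope from \<open>d\<close> to \<open>e\<close>, then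
  \<open>l * weight d\<close> is a slope from \<open>c\<close> to \<open>e\<close>; if it is 1, then
  \<open>l\<close> is itself a slope of \<open>c\<close>.\<close>

lemma weight_slope:
  assumes "c \<in> A" "d \<in> A" "slope c d l"
  shows "l * weight d \<le> weight c"
proof -
  have "weight d \<in> insert 1 {l. \<exists>e\<in>A. slope d e l}"
    unfolding weight_def using finite_slopes assms by (intro Max_in) auto
  then consider "weight d = 1" | e where "e \<in> A" "slope d e (weight d)" by blast
  then show ?thesis
    using assms slope_trans slope_le_weight by cases auto
qed

section \<open>Left multiplication by a generator\<close>

lemma power_mult_bound:
  assumes A: "a \<in> A" "c \<in> A" "d \<in> A"
  shows "\<exists>K. \<forall>r t. 0 < r \<longrightarrow> 0 < t \<longrightarrow> f a (pw c r) = pw d t \<longrightarrow>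
           weight d * real t \<le> weight c * real r + K"
proof (cases "\<exists>r>0. \<exists>t>0. f a (pw c r) = pw d t")
  case True
  \<comment> \<open>The solution with least exponent of \<open>c\<close> is the reference point; the
    constant will be \<open>weight d * real t0\<close>.\<close>
  define r0 where "r0 = (LEAST r. 0 < r \<and> (\<exists>t>0. f a (pw c r) = pw d t))"
  have "0 < r0 \<and> (\<exists>t>0. f a (pw c r0) = pw d t)"
    unfolding r0_def by (rule LeastI_ex[OF True])
  then obtain t0 where 0: "0 < r0" "0 < t0" "f a (pw c r0) = pw d t0" by blast
  have "weight d * real t \<le> weight c * real r + weight d * real t0"
    if rt: "0 < r" "0 < t" "f a (pw c r) = pw d t" for r t
  proof (cases "t \<le> t0")
    case True
    then have "weight d * real t \<le> weight d * real t0"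
      using weight_ge_1 A by (intro mult_left_mono) (auto intro: order_trans[of 0 1])
    then show ?thesis using weight_ge_1[OF A(2)] by (simp add: add_increasing)
  next
    case False
    have "r0 \<le> r" unfolding r0_def using rt by (blast intro: Least_le)
    \<comment> \<open>Equal exponents of \<open>c\<close> would give
      \<open>pw d t = pw d t0\<close>, contradicting \<open>t > t0\<close>.\<close>
    moreover have "r \<noteq> r0" using False rt 0 A pw_eq_iff by auto
    ultimately have "r0 < r" by simp
    define s \<sigma> where "s = r - r0" and "\<sigma> = t - t0"
    have s: "0 < s" "r = r0 + s" "0 < \<sigma>" "t = t0 + \<sigma>"
      using \<open>r0 < r\<close> False by (auto simp: s_def \<sigma>_def)
    have aS: "a \<in> S" using A gens by blast
    have base: "f (pw d t0) (pw c s) = pw d (t0 + \<sigma>)"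
    proof -
      have "f (pw d t0) (pw c s) = f (f a (pw c r0)) (pw c s)" by (simp only: 0(3))
      also have "\<dots> = f a (pw c (r0 + s))"
        using 0(1) s(1) A aS by (simp add: pw_add assoc pw_closed)
      finally show ?thesis using rt s by simp
    qed
    \<comment> \<open>Left multiplication by \<open>pw d k\<close> carries the relation from
      \<open>t0\<close> to every larger exponent. The case \<open>v = t0\<close> is separate because
      \<open>pw d 0\<close> is unspecified.\<close>
    have "f (pw d v) (pw c s) = pw d (v + \<sigma>)" if "t0 \<le> v" for v
    proof (cases "v = t0")
      case False
      define k where "k = v - t0"
      have k: "0 < k" "v = k + t0" using that False by (auto simp: k_def)
      have "f (pw d v) (pw c s) = f (pw d k) (f (pw d t0) (pw c s))"
        using k 0 s A by (simp add: pw_add assoc pw_closed)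
      also have "\<dots> = pw d (k + (t0 + \<sigma>))"
        unfolding base using k 0 A by (simp add: pw_add[of d k])
      finally show ?thesis using k by (simp add: add.assoc)
    qed (simp add: base)
    then have "shifts c d s \<sigma> t0" using s 0 by (simp add: shifts_def)
    then have "slope c d (real \<sigma> / real s)" by (auto simp: slope_def)
    then have "real \<sigma> / real s * weight d \<le> weight c" by (rule weight_slope[OF A(2,3)])
    then have "weight d * real \<sigma> \<le> weight c * real s"
      using s by (simp add: field_simps)
    moreover have "weight c * real s \<le> weight c * real r"
      using s weight_ge_1[OF A(2)] by simp
    ultimately show ?thesis using s by (simp add: distrib_left)
  qed
  then show ?thesis by blast
qed blast

lemma uniform_power_mult_bound:
  "\<exists>K\<ge>0. \<forall>a\<in>A. \<forall>c\<in>A. \<forall>d\<in>A. \<forall>r t. 0 < r \<longrightarrow> 0 < t \<longrightarrow> f a (pw c r) = pw d t \<longrightarrow>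
           weight d * real t \<le> weight c * real r + K"
proof -
  obtain K where K: "\<And>a c d r t. a \<in> A \<Longrightarrow> c \<in> A \<Longrightarrow> d \<in> A \<Longrightarrow> 0 < r \<Longrightarrow> 0 < t \<Longrightarrow>
      f a (pw c r) = pw d t \<Longrightarrow> weight d * real t \<le> weight c * real r + K a c d"
    using power_mult_bound by metis
  \<comment> \<open>A sum of absolute values dominates every \<open>K a c d\<close> and is
    nonnegative even for empty \<open>A\<close>.\<close>
  define M where "M = (\<Sum>(a,c,d)\<in>A \<times> A \<times> A. \<bar>K a c d\<bar>)"
  have "K a c d \<le> M" if "a \<in> A" "c \<in> A" "d \<in> A" for a c d
  proof -
    have "(\<lambda>(a,c,d). \<bar>K a c d\<bar>) (a,c,d) \<le> M"
      unfolding M_def using that gens by (intro member_le_sum) auto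
    then show ?thesis by simp
  qed
  moreover have "0 \<le> M" unfolding M_def by (intro sum_nonneg) auto
  ultimately have "weight d * real t \<le> weight c * real r + M"
    if "a \<in> A" "c \<in> A" "d \<in> A" "0 < r" "0 < t" "f a (pw c r) = pw d t" for a c d r t
    using K[OF that] that by fastforce
  then show ?thesis using \<open>0 \<le> M\<close> by blast
qed

section \<open>Word length and growth\<close>

lemma carrier_power_cases:
  assumes "x \<in> S"
  obtains d t where "d \<in> A" "0 < t" "x = pw d t"
  using assms union by (auto simp: monogenic_def Suc_le_eq)

text \<open>Induction on the word: each letter prepended adds at most \<open>K\<close> to the
  weighted exponent, and one-letter words are covered by \<open>W\<close>.\<close>

lemma word_prod_weight_bound:
  "\<exists>M. \<forall>w d t. w \<noteq> [] \<longrightarrow> set w \<subseteq> A \<longrightarrow> d \<in> A \<longrightarrow> 0 < t \<longrightarrow> word_prod f w = pw d t \<longrightarrow>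
     weight d * real t \<le> M * real (length w)"
proof -
  obtain K where K: "K \<ge> 0"
    "\<And>a c d r t. a \<in> A \<Longrightarrow> c \<in> A \<Longrightarrow> d \<in> A \<Longrightarrow> 0 < r \<Longrightarrow> 0 < t \<Longrightarrow>
       f a (pw c r) = pw d t \<Longrightarrow> weight d * real t \<le> weight c * real r + K"
    using uniform_power_mult_bound by blast
  obtain W where W: "\<And>a c t. a \<in> A \<Longrightarrow> c \<in> A \<Longrightarrow> 0 < t \<Longrightarrow> a = pw c t \<Longrightarrow> weight c * real t \<le> W"
  proof -
    \<comment> \<open>The exponent is unique by injectivity whenever it exists; otherwise
      \<open>THE\<close> gives an arbitrary value, harmless in a sum of absolute values.\<close>
    define g where "g = (\<lambda>a c. weight c * real (THE t. 0 < t \<and> a = pw c t))"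
    have "weight c * real t \<le> (\<Sum>(a,c)\<in>A \<times> A. \<bar>g a c\<bar>)"
      if "a \<in> A" "c \<in> A" "0 < t" "a = pw c t" for a c t
    proof -
      have "(THE t. 0 < t \<and> a = pw c t) = t"
        using that by (intro the_equality) (auto simp: pw_eq_iff)
      then have "weight c * real t \<le> (\<lambda>(a,c). \<bar>g a c\<bar>) (a,c)"
        by (simp add: g_def)
      also have "\<dots> \<le> (\<Sum>(a,c)\<in>A \<times> A. \<bar>g a c\<bar>)"
        using that gens by (intro member_le_sum) auto
      finally show ?thesis .
    qed
    then show thesis using that by blast
  qed
  define M where "M = K + \<bar>W\<bar>"
  \<comment> \<open>Membership in \<open>S\<close> is carried along because the induction step must
    write the shorter product as some \<open>pw c r\<close>.\<close>
  have "word_prod f w \<in> S \<and> (\<forall>d t. d \<in> A \<longrightarrow> 0 < t \<longrightarrow> word_prod f w = pw d t \<longrightarrow>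
          weight d * real t \<le> M * real (length w))"
    if "w \<noteq> []" "set w \<subseteq> A" for w
    using that
  proof (induction w rule: list_nonempty_induct)
    case (single a)
    have "weight d * real t \<le> M" if "d \<in> A" "0 < t" "a = pw d t" for d t
      using W[of a d t] that single K(1) by (simp add: M_def)
    then show ?case using single gens by auto
  next
    case (cons a w)
    have prod: "word_prod f (a # w) = f a (word_prod f w)"
      using \<open>w \<noteq> []\<close> by (cases w) auto
    have IH: "word_prod f w \<in> S" "\<And>d t. d \<in> A \<Longrightarrow> 0 < t \<Longrightarrow> word_prod f w = pw d t \<Longrightarrow>
          weight d * real t \<le> M * real (length w)"
      using cons by auto
    obtain c r where cr: "c \<in> A" "0 < r" "word_prod f w = pw c r"
      using IH(1) by (rule carrier_power_cases)
    have "weight d * real t \<le> M * real (length (a # w))"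
      if "d \<in> A" "0 < t" "word_prod f (a # w) = pw d t" for d t
    proof -
      have "weight d * real t \<le> weight c * real r + K"
        using that cons.prems cr prod by (intro K(2)[of a]) auto
      also have "\<dots> \<le> M * real (length w) + M"
        using IH(2)[OF cr] by (simp add: M_def)
      finally show ?thesis by (simp add: algebra_simps)
    qed
    moreover have "word_prod f (a # w) \<in> S"
      using prod IH(1) cons.prems gens by (auto intro: closed)
    ultimately show ?case by blast
  qed
  then show ?thesis by blast
qed

lemma linear_growth:
  "\<exists>C::real. C > 0 \<and> (\<forall>m::nat. m \<ge> 1 \<longrightarrow>
     finite (words_ball S f A m) \<and> real (card (words_ball S f A m)) \<le> C * real m)"
proof -
  obtain M where M: "\<And>w d t. w \<noteq> [] \<Longrightarrow> set w \<subseteq> A \<Longrightarrow> d \<in> A \<Longrightarrow> 0 < t \<Longrightarrow>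
      word_prod f w = pw d t \<Longrightarrow> weight d * real t \<le> M * real (length w)"
    using word_prod_weight_bound by blast
  \<comment> \<open>The absolute value is taken because the sign of \<open>M\<close> is not known
    here.\<close>
  define N where "N = nat \<lceil>\<bar>M\<bar>\<rceil>"
  \<comment> \<open>Weights are at least 1, so elements of the ball are powers with exponent at most
    \<open>N * m\<close>; counting pairs of generator and exponent gives the linear bound.\<close>
  have ball: "words_ball S f A m \<subseteq> (\<lambda>(d,t). pw d t) ` (A \<times> {1..N * m})" for m
  proof
    fix x assume "x \<in> words_ball S f A m"
    then obtain w where "x \<in> S" "1 \<le> length w" "length w \<le> m" "set w \<subseteq> A" "x = word_prod f w"
      unfolding words_ball_def by blast
    then have w: "x \<in> S" "w \<noteq> []" "length w \<le> m" "set w \<subseteq> A" "x = word_prod f w"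
      by auto
    obtain d t where dt: "d \<in> A" "0 < t" "x = pw d t"
      using w(1) by (rule carrier_power_cases)
    have "real t \<le> weight d * real t"
      using weight_ge_1[OF dt(1)] by (simp add: mult_le_cancel_right1)
    also have "\<dots> \<le> M * real (length w)"
      using M w dt by metis
    also have "\<dots> \<le> real N * real m"
      using w(3) unfolding N_def by (intro mult_mono) linarith+
    finally have "t \<le> N * m"
      by (metis of_nat_le_iff of_nat_mult)
    then show "x \<in> (\<lambda>(d,t). pw d t) ` (A \<times> {1..N * m})"
      using dt by force
  qed
  have fin: "finite (A \<times> {1..N * m})" for m
    using gens by simp
  have "card (words_ball S f A m) \<le> card A * (N * m)" for m
    using card_mono[OF finite_imageI[OF fin] ball, of m]
      card_image_le[OF fin, of "\<lambda>(d,t). pw d t" m]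
    by (simp add: card_cartesian_product)
  then have "real (card (words_ball S f A m)) \<le> real (card A * (N * m))" for m
    by (simp only: of_nat_le_iff)
  \<comment> \<open>The added 1 keeps the constant positive even when \<open>card A * N\<close> is
    0.\<close>
  then have "real (card (words_ball S f A m)) \<le> real (card A * N + 1) * real m" for m
    by (rule order_trans) (simp add: algebra_simps)
  moreover have "finite (words_ball S f A m)" for m
    using finite_subset[OF ball] fin by blast
  ultimately show ?thesis
    by (intro exI[of _ "real (card A * N + 1)"]) (auto simp del: of_nat_add of_nat_Suc)
qed

end

theorem theorem2p10:
  fixes S A :: "'a set" and f :: "'a \<Rightarrow> 'a \<Rightarrow> 'a"
  assumes "semigroup_on S f"
    and "A \<subseteq> S" and "finite A"
    and "\<And>a. a \<in> A \<Longrightarrow> subsemigroup (monogenic f a) S f"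
    and "\<And>a. a \<in> A \<Longrightarrow>
           semigroup_isomorphic (monogenic f a) f ({0<..} :: nat set) (+)"
    and "S = (\<Union>a\<in>A. monogenic f a)"
    and "disjoint_family_on (monogenic f) A"
  shows "\<exists>C::real. C > 0 \<and>
           (\<forall>m::nat. m \<ge> 1 \<longrightarrow>
              finite (words_ball S f A m) \<and> real (card (words_ball S f A m)) \<le> C * real m)"
proof -
  have "inj_on (pos_power f a) {0<..}" if a: "a \<in> A" for a
  proof -
    obtain h where h: "bij_betw h (monogenic f a) ({0<..} :: nat set)"
      "\<And>x y. x \<in> monogenic f a \<Longrightarrow> y \<in> monogenic f a \<Longrightarrow> h (f x y) = h x + h y"
      using assms(5)[OF a] unfolding semigroup_isomorphic_def by blast
    have mem: "pos_power f a i \<in> monogenic f a" if "0 < i" for i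
      using that by (auto simp: monogenic_def Suc_le_eq)
    have one: "pos_power f a 1 = a" by (simp add: pos_power_def)
    \<comment> \<open>The isomorphism is additive, so it scales exponents by the positive number
      \<open>h a\<close>; hence distinct exponents give distinct powers.\<close>
    have "h (pos_power f a i) = i * h a" if "0 < i" for i
      using that
    proof (induction i rule: nat_induct_non_zero)
      case 1
      then show ?case by (simp add: pos_power_def)
    next
      case (Suc i)
      have "pos_power f a (Suc i) = f a (pos_power f a i)"
        using Suc(1) by (cases i) (simp_all add: pos_power_def)
      then show ?case using h(2)[of a] mem[of 1] mem[of i] one Suc by simp
    qed
    moreover have "0 < h a"
      using h(1) mem[of 1] one by (auto dest: bij_betwE)
    ultimately show ?thesis
      by (intro inj_onI) (metis greaterThan_iff mult_right_cancel less_irrefl)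
  qed
  then interpret monogenic_union S A f
    using assms by unfold_locales auto
  show ?thesis by (rule linear_growth)
qed

end
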